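(* Let $(X,d)$ be a separable metric space such that the action $(Iso(X),X)$ is Cauchy-indivisible. Then the set $X\cup X_p$ is the maximal subset of $X\cup X_l$ that contains $X$ such that the map $$\omega: E\times (X\cup X_p)\to (X\cup X_p)\times\widehat{X},\qquad \omega(f,y)=(y,fy),$$ is proper. That is, this map is proper, and if $X\subset Y\subset X\cup X_l$ is such that the map $E\times Y\to Y\times\widehat X$, $(f,y)\mapsto (y,fy)$, is proper, then $Y\subset X\cup X_p$.
   Context: $Iso(X)$ is the group of surjective isometries of $(X,d)$ with the topology of pointwise convergence; it acts on $X$ by evaluation. For a net $\{z_i\}$ in a space $Z$, "$z_i\to\infty$ in $Z$" means that $\{z_i\}$ has no convergent subnet in $Z$. The action $(Iso(X),X)$ is Cauchy-indivisible if: whenever $\{g_i\}$ is a net in $Iso(X)$ with $g_i\to\infty$ in $Iso(X)$ and $\{g_ix\}$ is a Cauchy net for some $x\in X$, then $\{g_ix\}$ is a Cauchy net for every $x\in X$. $(\widehat X,\widehat d)$ is the completion of $(X,d)$; $\widehat g$ is the extension of $g\in Iso(X)$ to $\widehat X$, and $\widehat{Iso(X)}=\{\widehat g: g\in Iso(X)\}$. $C(\widehat X,\widehat X)$ is the space of continuous selfmaps of $\widehat X$ with the topology of pointwise convergence. $E$ (the Ellis semigroup) is the closure of $\widehat{Iso(X)}$ in $C(\widehat X,\widehat X)$, with the topology of pointwise convergence. Put $H=\{h\in C(\widehat X,\widehat X):$ there is a sequence $\{g_n\}\subset Iso(X)$ with $g_n\to\infty$ in $Iso(X)$ and $\widehat{g_n}\to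 h$ in $C(\widehat X,\widehat X)\}$, $X_l=\{hx: h\in H,\ x\in X\}$, and $X_p=\{hx: h\in H\cap Iso(\widehat X),\ x\in X\}$. A continuous map is proper in the sense of Bourbaki (closed with compact fibers; for metrizable spaces equivalently, preimages of compact sets are compact). *)

theory Defs
  imports "HOL-Analysis.Analysis"
begin

text \<open>
  All function spaces carry the topology of pointwise convergence, which is the library's
  (product) topology on the function type.

  Nets are represented by the proper filters generated by their tails. HOL cannot quantify over
  index types inside a definition, and every proper filter is the tail filter of some net. Passing
  to a subnet amounts to passing to a finer proper filter; \<open>subnet_of_finer_filter\<close> below is the
  nontrivial half of both correspondences.
\<close>

definition directed :: "'i set \<Rightarrow> ('i \<Rightarrow> 'i \<Rightarrow> bool) \<Rightarrow> bool" where
  "directed I le \<longleftrightarrow> I \<noteq> {} \<and> (\<forall>i\<in>I. le i i) \<and>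
     (\<forall>i\<in>I. \<forall>j\<in>I. \<forall>k\<in>I. le i j \<longrightarrow> le j k \<longrightarrow> le i k) \<and>
     (\<forall>i\<in>I. \<forall>j\<in>I. \<exists>k\<in>I. le i k \<and> le j k)"

definition tail_filter :: "'i set \<Rightarrow> ('i \<Rightarrow> 'i \<Rightarrow> bool) \<Rightarrow> ('i \<Rightarrow> 'z) \<Rightarrow> 'z filter" where
  "tail_filter I le z = (INF i\<in>I. principal (z ` {j\<in>I. le i j}))"

lemma eventually_tail_filter:
  assumes "directed I le"
  shows "eventually P (tail_filter I le z) \<longleftrightarrow> (\<exists>i\<in>I. \<forall>j\<in>I. le i j \<longrightarrow> P (z j))"
proof -
  have "eventually P (tail_filter I le z) \<longleftrightarrow>
      (\<exists>i\<in>I. eventually P (principal (z ` {j\<in>I. le i j})))"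
    unfolding tail_filter_def
  proof (rule eventually_INF_base)
    show "I \<noteq> {}" using assms by (simp add: directed_def)
    fix a b assume ab: "a \<in> I" "b \<in> I"
    then obtain c where c: "c \<in> I" "le a c" "le b c"
      using assms unfolding directed_def by meson
    have "z ` {j\<in>I. le c j} \<subseteq> z ` {j\<in>I. le a j} \<inter> z ` {j\<in>I. le b j}"
      using assms ab c unfolding directed_def by blast
    then show "\<exists>x\<in>I. principal (z ` {j\<in>I. le x j})
        \<le> inf (principal (z ` {j\<in>I. le a j})) (principal (z ` {j\<in>I. le b j}))"
      using c(1) by (auto simp only: inf_principal principal_le_iff)
  qed
  then show ?thesis by (auto simp: eventually_principal)
qed

lemma tail_filter_proper:
  assumes "directed I le"
  shows "tail_filter I le z \<noteq> bot"
proof -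
  have "\<forall>i\<in>I. le i i" using assms unfolding directed_def by (elim conjE)
  then show ?thesis
    unfolding trivial_limit_def eventually_tail_filter[OF assms] by blast
qed

text \<open>
  Taking \<open>I = UNIV\<close>, \<open>le = (\<lambda>_ _. True)\<close> and \<open>z = id\<close>, whose tail filter is \<open>top\<close>, this says in
  particular that every proper filter is the tail filter of a net.
\<close>

lemma subnet_of_finer_filter:
  fixes z :: "'i \<Rightarrow> 'z"
  assumes dir: "directed I le" and G: "G \<noteq> bot" "G \<le> tail_filter I le z"
  shows "\<exists>(J :: ('z set \<times> 'i) set) le' \<phi>. directed J le' \<and> \<phi> ` J \<subseteq> I \<and>
           (\<forall>j\<in>J. \<forall>k\<in>J. le' j k \<longrightarrow> le (\<phi> j) (\<phi> k)) \<and>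
           (\<forall>i\<in>I. \<exists>j\<in>J. le i (\<phi> j)) \<and>
           tail_filter J le' (z \<circ> \<phi>) = G"
proof -
  define J where "J = {(A, i). eventually (\<lambda>x. x \<in> A) G \<and> i \<in> I \<and> z i \<in> A}"
  define le' where "le' = (\<lambda>(p :: 'z set \<times> 'i) q. fst q \<subseteq> fst p \<and> le (snd p) (snd q))"
  have tail: "eventually (\<lambda>x. x \<in> z ` {j\<in>I. le i j}) G" if "i \<in> I" for i
  proof -
    have "eventually (\<lambda>x. x \<in> z ` {j\<in>I. le i j}) (tail_filter I le z)"
      unfolding eventually_tail_filter[OF dir] using that by blast
    then show ?thesis using G(2) by (simp add: le_filter_def)
  qed
  have meet: "\<exists>j\<in>I. le i j \<and> z j \<in> A" if "i \<in> I" "eventually (\<lambda>x. x \<in> A) G" for i A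
  proof -
    have "eventually (\<lambda>x. x \<in> z ` {j\<in>I. le i j} \<and> x \<in> A) G"
      using tail[OF that(1)] that(2) by (rule eventually_conj)
    from eventually_happens'[OF G(1) this] show ?thesis by auto
  qed
  have refl': "\<forall>i\<in>I. le i i"
    and trans': "\<forall>i\<in>I. \<forall>j\<in>I. \<forall>k\<in>I. le i j \<longrightarrow> le j k \<longrightarrow> le i k"
    and ub': "\<forall>i\<in>I. \<forall>j\<in>I. \<exists>k\<in>I. le i k \<and> le j k"
    using dir[unfolded directed_def] by - (elim conjE, assumption)+
  note refl = refl'[rule_format] and trans = trans'[rule_format] and ub = ub'[rule_format]
  have ubJ: "\<exists>r\<in>J. le' p r \<and> le' q r" if "p \<in> J" "q \<in> J" for p q
  proof -
    obtain A i B k where p: "p = (A, i)" and q: "q = (B, k)" by fastforce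
    have 1: "eventually (\<lambda>x. x \<in> A) G" "eventually (\<lambda>x. x \<in> B) G" "i \<in> I" "k \<in> I"
      using that by (auto simp: J_def p q)
    have AB: "eventually (\<lambda>x. x \<in> A \<inter> B) G"
      using eventually_conj[OF 1(1,2)] by simp
    obtain l where l: "l \<in> I" "le i l" "le k l" using ub[OF 1(3,4)] by blast
    obtain m where m: "m \<in> I" "le l m" "z m \<in> A \<inter> B" using meet[OF l(1) AB] by blast
    have "(A \<inter> B, m) \<in> J" using AB m by (simp add: J_def)
    moreover have "le' p (A \<inter> B, m)" "le' q (A \<inter> B, m)"
      using trans[OF 1(3) l(1) m(1) l(2) m(2)] trans[OF 1(4) l(1) m(1) l(3) m(2)]
      by (simp_all add: le'_def p q)
    ultimately show ?thesis by blast
  qed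
  obtain i0 where i0: "i0 \<in> I" using dir by (auto simp: directed_def)
  have dJ: "directed J le'"
  proof -
    have "(UNIV, i0) \<in> J" using i0 by (simp add: J_def)
    moreover have "\<forall>p\<in>J. le' p p" using refl by (auto simp: J_def le'_def)
    moreover have "\<forall>p\<in>J. \<forall>q\<in>J. \<forall>r\<in>J. le' p q \<longrightarrow> le' q r \<longrightarrow> le' p r"
    proof (intro ballI impI)
      fix p q r assume "p \<in> J" "q \<in> J" "r \<in> J" and le: "le' p q" "le' q r"
      then have "snd p \<in> I" "snd q \<in> I" "snd r \<in> I" by (auto simp: J_def)
      with trans[of "snd p" "snd q" "snd r"] le show "le' p r" by (auto simp: le'_def)
    qed
    moreover have "\<forall>p\<in>J. \<forall>q\<in>J. \<exists>r\<in>J. le' p r \<and> le' q r" using ubJ by blast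
    ultimately show ?thesis unfolding directed_def by (intro conjI) (blast | assumption)+
  qed
  have "tail_filter J le' (z \<circ> snd) = G"
  proof (rule filter_eqI)
    fix P
    show "eventually P (tail_filter J le' (z \<circ> snd)) = eventually P G"
    proof
      assume "eventually P (tail_filter J le' (z \<circ> snd))"
      then obtain A i where Ai: "(A, i) \<in> J"
        and *: "\<forall>q\<in>J. le' (A, i) q \<longrightarrow> P ((z \<circ> snd) q)"
        unfolding eventually_tail_filter[OF dJ] by (metis surj_pair)
      then have A: "eventually (\<lambda>x. x \<in> A) G" and i: "i \<in> I" by (auto simp: J_def)
      show "eventually P G"
        using A tail[OF i]
      proof eventually_elim
        case (elim x)
        then obtain j where j: "j \<in> I" "le i j" "x = z j" by auto
        have "(A, j) \<in> J" "le' (A, i) (A, j)"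
          using j elim A by (auto simp: J_def le'_def)
        then show ?case using * j by fastforce
      qed
    next
      assume P: "eventually P G"
      then obtain j where j: "j \<in> I" "P (z j)" using meet[OF i0, of "Collect P"] by auto
      have "(Collect P, j) \<in> J" using P j by (simp add: J_def)
      moreover have "\<forall>q\<in>J. le' (Collect P, j) q \<longrightarrow> P ((z \<circ> snd) q)"
        by (auto simp: J_def le'_def)
      ultimately show "eventually P (tail_filter J le' (z \<circ> snd))"
        unfolding eventually_tail_filter[OF dJ] by blast
    qed
  qed
  moreover have "\<forall>i\<in>I. \<exists>j\<in>J. le i (snd j)"
    using refl by (auto simp: J_def intro!: exI[of _ UNIV])
  moreover have "snd ` J \<subseteq> I" by (auto simp: J_def)
  moreover have "\<forall>j\<in>J. \<forall>k\<in>J. le' j k \<longrightarrow> le (snd j) (snd k)"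
    by (simp add: le'_def)
  ultimately show ?thesis
    using dJ by (intro exI[of _ J] exI[of _ le'] exI[of _ snd] conjI)
qed

text \<open>\<open>F \<rightarrow> \<infinity>\<close> in \<open>Z\<close>: no subnet (finer proper filter) converges to a point of \<open>Z\<close>.\<close>

definition to_infinity_in :: "'z::topological_space set \<Rightarrow> 'z filter \<Rightarrow> bool" where
  "to_infinity_in Z F \<longleftrightarrow> \<not> (\<exists>z\<in>Z. \<exists>G. G \<noteq> bot \<and> G \<le> F \<and> ((\<lambda>x. x) \<longlongrightarrow> z) G)"

definition Iso :: "('a::metric_space \<Rightarrow> 'a) set" where
  "Iso = {g. surj g \<and> (\<forall>x y. dist (g x) (g y) = dist x y)}"

definition cauchy_indivisible :: "('a::metric_space \<Rightarrow> 'a) set \<Rightarrow> bool" where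
  "cauchy_indivisible \<G> \<longleftrightarrow>
     (\<forall>F. F \<noteq> bot \<and> F \<le> principal \<G> \<and> to_infinity_in \<G> F \<and>
          (\<exists>x. cauchy_filter (filtermap (\<lambda>g. g x) F)) \<longrightarrow>
          (\<forall>x. cauchy_filter (filtermap (\<lambda>g. g x) F)))"

text \<open>
  A completion of the metric space \<open>'a\<close> is given by an isometric embedding with dense image into
  a complete metric space; \<open>range \<iota>\<close> is the copy of \<open>X\<close> inside it.
\<close>

definition is_completion :: "('a::metric_space \<Rightarrow> 'b::complete_space) \<Rightarrow> bool" where
  "is_completion \<iota> \<longleftrightarrow> (\<forall>x y. dist (\<iota> x) (\<iota> y) = dist x y) \<and> closure (range \<iota>) = UNIV"

definition extension ::
    "('a::metric_space \<Rightarrow> 'b::complete_space) \<Rightarrow> ('a \<Rightarrow> 'a) \<Rightarrow> ('b \<Rightarrow> 'b)" where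
  "extension \<iota> g = (THE h. continuous_on UNIV h \<and> (\<forall>x. h (\<iota> x) = \<iota> (g x)))"

definition Cont :: "('b::topological_space \<Rightarrow> 'b) set" where
  "Cont = {f. continuous_on UNIV f}"

definition Ellis :: "('a::metric_space \<Rightarrow> 'b::complete_space) \<Rightarrow> ('b \<Rightarrow> 'b) set" where
  "Ellis \<iota> = top_of_set Cont closure_of (extension \<iota> ` Iso)"

definition Hlim :: "('a::metric_space \<Rightarrow> 'b::complete_space) \<Rightarrow> ('b \<Rightarrow> 'b) set" where
  "Hlim \<iota> = {h \<in> Cont. \<exists>g :: nat \<Rightarrow> 'a \<Rightarrow> 'a. (\<forall>n. g n \<in> Iso) \<and>
      to_infinity_in Iso (filtermap g sequentially) \<and>
      (\<lambda>n. extension \<iota> (g n)) \<longlonglongrightarrow> h}"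

definition X_l :: "('a::metric_space \<Rightarrow> 'b::complete_space) \<Rightarrow> 'b set" where
  "X_l \<iota> = {h (\<iota> x) | h x. h \<in> Hlim \<iota>}"

definition X_p :: "('a::metric_space \<Rightarrow> 'b::complete_space) \<Rightarrow> 'b set" where
  "X_p \<iota> = {h (\<iota> x) | h x. h \<in> Hlim \<iota> \<inter> Iso}"

text \<open>The library's \<open>proper_map\<close> (closed with compact fibres) does not include continuity.\<close>

definition bourbaki_proper :: "'x topology \<Rightarrow> 'y topology \<Rightarrow> ('x \<Rightarrow> 'y) \<Rightarrow> bool" where
  "bourbaki_proper S T f \<longleftrightarrow> continuous_map S T f \<and> proper_map S T f"

definition omega_proper :: "('a::metric_space \<Rightarrow> 'b::complete_space) \<Rightarrow> 'b set \<Rightarrow> bool" where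
  "omega_proper \<iota> Y \<longleftrightarrow>
     bourbaki_proper
       (prod_topology (top_of_set (Ellis \<iota>)) (top_of_set Y))
       (prod_topology (top_of_set Y) euclidean)
       (\<lambda>(f, y). (y, f y))"

end

theory Submission
  imports Defs
begin

text \<open>
  The map \<open>(f, y) \<mapsto> (y, f y)\<close> on \<open>E \<times> Y\<close> is proper as soon as every filter of maps \<open>f\<close> in \<open>E\<close>
  along which \<open>f y\<close> converges, for some \<open>y \<in> Y\<close>, has a cluster point in \<open>E\<close>.
  For \<open>y \<in> X\<close> the filter is approximated by one on \<open>Iso\<close>: if that does not tend to infinity, it clusters at an isometry of \<open>X\<close>, and otherwise
  Cauchy-indivisibility makes it converge pointwise on \<open>X\<close>, hence on the completion. For
  \<open>y = h x\<close> with \<open>h\<close> an invertible element of \<open>H\<close> one passes from \<open>f\<close> to \<open>f \<circ> h\<close> and back.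
  Conversely, if \<open>g\<^sub>n \<longrightarrow> h\<close> and \<open>y = h x \<in> Y\<close>, then \<open>g\<^sub>n\<inverse> y \<longrightarrow> x\<close>, so by properness the
  \<open>g\<^sub>n\<inverse>\<close> cluster at some \<open>k\<close>, and \<open>h \<circ> k = id\<close> shows that \<open>h\<close> is onto.
\<close>

section \<open>Filters and pointwise convergence\<close>

lemma tendsto_fun_iff:
  fixes f :: "'i \<Rightarrow> 'a \<Rightarrow> 'b::topological_space"
  shows "(f \<longlongrightarrow> l) F \<longleftrightarrow> (\<forall>x. ((\<lambda>i. f i x) \<longlongrightarrow> l x) F)"
  using limitin_componentwise[of "\<lambda>_. euclidean :: 'b topology" UNIV f l F]
  by (simp add: euclidean_product_topology)

text \<open>Passes from a subnet of an image net to a subnet of the net itself. \<open>F'\<close>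
  adds to \<open>F\<close> the preimages of the sets of \<open>G\<close>; it is proper because each
  set of \<open>G\<close> meets the image of each set of \<open>F\<close>.\<close>

lemma finer_filter_lift:
  assumes "G \<noteq> bot" "G \<le> filtermap f F"
  obtains F' where "F' \<noteq> bot" "F' \<le> F" "filtermap f F' \<le> G"
proof
  let ?F = "inf F (filtercomap f G)"
  show "?F \<le> F" by simp
  show "filtermap f ?F \<le> G"
    using filtermap_mono[of ?F "filtercomap f G" f] filtermap_filtercomap[of f G] by simp
  show "?F \<noteq> bot"
  proof
    assume "?F = bot"
    then obtain Q R where Q: "eventually Q F" and R: "eventually R (filtercomap f G)"
      and QR: "\<forall>x. \<not> (Q x \<and> R x)"
      by (auto simp: trivial_limit_def eventually_inf)
    obtain S where S: "eventually S G" "\<And>x. S (f x) \<Longrightarrow> R x"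
      using R by (auto simp: eventually_filtercomap)
    have "eventually (\<lambda>x. \<not> S (f x)) F"
      using Q by (rule eventually_mono) (use QR S(2) in blast)
    then have "eventually (\<lambda>y. \<not> S y) G"
      using assms(2) by (simp add: le_filter_def eventually_filtermap)
    from eventually_conj[OF this S(1)] assms(1) show False
      by (simp add: trivial_limit_def)
  qed
qed

lemma cluster_point_finer_filter:
  assumes "compact K" "F \<noteq> bot" "eventually (\<lambda>i. f i \<in> K) F"
  obtains k G where "k \<in> K" "G \<noteq> bot" "G \<le> F" "(f \<longlongrightarrow> k) G"
proof -
  have "filtermap f F \<noteq> bot" "eventually (\<lambda>x. x \<in> K) (filtermap f F)"
    using assms by (simp_all add: filtermap_bot_iff eventually_filtermap)
  then obtain k where k: "k \<in> K" "inf (nhds k) (filtermap f F) \<noteq> bot"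
    using assms(1) unfolding compact_filter by blast
  obtain G where "G \<noteq> bot" "G \<le> F" "filtermap f G \<le> inf (nhds k) (filtermap f F)"
    by (rule finer_filter_lift[OF k(2), of f F]) auto
  with k(1) that show thesis by (auto simp: filterlim_def)
qed

lemma closure_fun_approx:
  fixes f :: "'a \<Rightarrow> 'b::metric_space"
  assumes "f \<in> closure S" "finite A" "e > 0"
  shows "\<exists>g\<in>S. \<forall>x\<in>A. dist (f x) (g x) < e"
proof -
  let ?U = "{g. \<forall>x\<in>A. g (id x) \<in> ball (f x) e}"
  \<comment> \<open>\<open>id\<close> brings the set into the shape of the basic open sets of
    \<open>product_topology_basis'\<close>, which constrain finitely many coordinates.\<close>
  have "open ?U" using assms(2) by (intro product_topology_basis') auto
  moreover have "f \<in> ?U" using assms(3) by simp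
  ultimately obtain g where "g \<in> S" "g \<in> ?U"
    using assms(1) unfolding closure_iff_nhds_not_empty by blast
  then show ?thesis by auto
qed

lemma tendsto_of_dist:
  fixes f :: "'i \<Rightarrow> 'b::metric_space"
  assumes "(f \<longlongrightarrow> l) F" "((\<lambda>i. dist (f i) (g i)) \<longlongrightarrow> 0) F"
  shows "(g \<longlongrightarrow> l) F"
proof -
  have "((\<lambda>i. dist (f i) (g i) + dist (f i) l) \<longlongrightarrow> 0 + 0) F"
    using assms by (intro tendsto_add) (simp_all add: tendsto_dist_iff[symmetric])
  moreover have "dist (g i) l \<le> dist (f i) (g i) + dist (f i) l" for i
    by (metis dist_commute dist_triangle)
  ultimately show ?thesis
    by (elim metric_tendsto_imp_tendsto) simp
qed

lemma continuous_eq_from_dense: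
  fixes f g :: "'a::topological_space \<Rightarrow> 'b::t2_space"
  assumes "continuous_on UNIV f" "continuous_on UNIV g" "closure D = UNIV"
    and "\<And>x. x \<in> D \<Longrightarrow> f x = g x"
  shows "f = g"
  using closure_minimal[OF _ closed_Collect_eq[OF assms(1,2)], of D] assms(3,4) by fastforce

section \<open>Isometric maps\<close>

text \<open>Surjectivity is left out because a pointwise limit of isometries keeps distances but may
  fail to be onto; two types are allowed so that \<open>\<iota>\<close> is covered.\<close>

definition isometric :: "('a::metric_space \<Rightarrow> 'b::metric_space) \<Rightarrow> bool" where
  "isometric f \<longleftrightarrow> (\<forall>x y. dist (f x) (f y) = dist x y)"

lemma isometricD: "isometric f \<Longrightarrow> dist (f x) (f y) = dist x y"
  by (simp add: isometric_def)

lemma isometric_continuous: "isometric f \<Longrightarrow> continuous_on S f"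
  by (auto simp: continuous_on_iff isometric_def)

lemma Iso_iff: "g \<in> Iso \<longleftrightarrow> surj g \<and> isometric g"
  by (simp add: Iso_def isometric_def)

lemma isometric_inj: "isometric f \<Longrightarrow> inj f"
  by (metis dist_eq_0_iff injI isometricD)

lemma inv_in_Iso:
  assumes "g \<in> Iso" shows "inv g \<in> Iso"
proof -
  have "bij g" using assms isometric_inj by (auto simp: Iso_iff bij_def)
  then show ?thesis
    using assms unfolding Iso_iff isometric_def
    by (metis bij_imp_bij_inv bij_is_surj surj_f_inv_f)
qed

text \<open>Isometric maps are equicontinuous: \<open>f i (u i)\<close> and \<open>f i y\<close> are
  as far apart as \<open>u i\<close> and \<open>y\<close>. This lets a moving argument be replaced
  by its limit.\<close>

lemma tendsto_isometric_eval:
  fixes f :: "'i \<Rightarrow> 'a::metric_space \<Rightarrow> 'b::metric_space"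
  assumes iso: "eventually (\<lambda>i. isometric (f i)) F" and u: "(u \<longlongrightarrow> y) F"
  shows "((\<lambda>i. f i (u i)) \<longlongrightarrow> z) F \<longleftrightarrow> ((\<lambda>i. f i y) \<longlongrightarrow> z) F"
proof -
  have "((\<lambda>i. dist (u i) y) \<longlongrightarrow> 0) F" using u by (simp add: tendsto_dist_iff[symmetric])
  moreover have "eventually (\<lambda>i. dist (u i) y = dist (f i (u i)) (f i y)) F"
    using iso by eventually_elim (simp add: isometricD)
  ultimately have *: "((\<lambda>i. dist (f i (u i)) (f i y)) \<longlongrightarrow> 0) F"
    by (rule Lim_transform_eventually)
  then have "((\<lambda>i. dist (f i y) (f i (u i))) \<longlongrightarrow> 0) F" by (simp add: dist_commute)
  with * show ?thesis by (blast intro: tendsto_of_dist)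
qed

lemma isometric_limit:
  fixes f :: "'i \<Rightarrow> 'a::metric_space \<Rightarrow> 'b::metric_space"
  assumes "F \<noteq> bot" "eventually (\<lambda>i. isometric (f i)) F" "(f \<longlongrightarrow> h) F"
  shows "isometric h"
  unfolding isometric_def
proof (intro allI)
  fix x y
  have "((\<lambda>i. dist (f i x) (f i y)) \<longlongrightarrow> dist (h x) (h y)) F"
    using assms(3) unfolding tendsto_fun_iff by (intro tendsto_dist) auto
  moreover have "eventually (\<lambda>i. dist (f i x) (f i y) = dist x y) F"
    using assms(2) by eventually_elim (simp add: isometricD)
  ultimately have "((\<lambda>i::'i. dist x y) \<longlongrightarrow> dist (h x) (h y)) F"
    by (rule Lim_transform_eventually)
  then show "dist (h x) (h y) = dist x y"
    using assms(1) by (metis tendsto_unique tendsto_const)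
qed

lemma convergent_iff_cauchy_filtermap:
  fixes f :: "'i \<Rightarrow> 'b::complete_space"
  shows "(\<exists>l. (f \<longlongrightarrow> l) F) \<longleftrightarrow> cauchy_filter (filtermap f F)"
  by (simp add: convergent_filter_iff_cauchy[symmetric] convergent_filter.simps filterlim_def)

lemma isometric_cauchy_filtermap:
  assumes "isometric \<iota>"
  shows "cauchy_filter (filtermap (\<lambda>i. \<iota> (f i)) F) \<longleftrightarrow> cauchy_filter (filtermap f F)"
  using assms by (simp add: cauchy_filter_metric_filtermap isometricD)

text \<open>An isometric map keeps \<open>w\<close> and a nearby point of \<open>D\<close> equally
  near, so the Cauchy property spreads from \<open>D\<close> to every point by an
  \<open>e / 3\<close> argument, and completeness supplies the limits.\<close>

lemma isometric_convergent_from_dense: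
  fixes f :: "'i \<Rightarrow> 'a::metric_space \<Rightarrow> 'b::complete_space"
  assumes iso: "eventually (\<lambda>i. isometric (f i)) F" and dense: "closure D = UNIV"
    and D: "\<And>x. x \<in> D \<Longrightarrow> \<exists>l. ((\<lambda>i. f i x) \<longlongrightarrow> l) F"
  shows "\<exists>k. (f \<longlongrightarrow> k) F"
proof -
  have "\<exists>l. ((\<lambda>i. f i w) \<longlongrightarrow> l) F" for w
    unfolding convergent_iff_cauchy_filtermap cauchy_filter_metric_filtermap
  proof (intro allI impI)
    fix e :: real assume "e > 0"
    then obtain x where x: "x \<in> D" "dist x w < e / 3"
      using dense closure_approachable[of w D] by (metis UNIV_I zero_less_divide_iff zero_less_numeral)
    obtain P where P: "eventually P F" "\<And>i j. P i \<Longrightarrow> P j \<Longrightarrow> dist (f i x) (f j x) < e / 3"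
      using D[OF x(1)] \<open>e > 0\<close>
      unfolding convergent_iff_cauchy_filtermap cauchy_filter_metric_filtermap
      by (metis zero_less_divide_iff zero_less_numeral)
    have "dist (f i w) (f j w) < e"
      if "P i" "isometric (f i)" "P j" "isometric (f j)" for i j
    proof -
      have "dist (f i w) (f i x) < e / 3" "dist (f j x) (f j w) < e / 3"
        using x that by (simp_all add: isometricD dist_commute)
      then show ?thesis using P(2)[OF that(1,3)]
        using dist_triangle[of "f i w" "f j w" "f i x"] dist_triangle[of "f i x" "f j w" "f j x"]
        by linarith
    qed
    then show "\<exists>P. eventually P F \<and> (\<forall>i j. P i \<and> P j \<longrightarrow> dist (f i w) (f j w) < e)"
      using eventually_conj[OF P(1) iso] by blast
  qed
  then have "\<exists>k. \<forall>w. ((\<lambda>i. f i w) \<longlongrightarrow> k w) F" by metis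
  then show ?thesis by (simp add: tendsto_fun_iff)
qed

section \<open>The Ellis semigroup of a completion\<close>

context
  fixes \<iota> :: "'a::metric_space \<Rightarrow> 'b::complete_space"
  assumes compl: "is_completion \<iota>"
begin

section \<open>Extension of isometries to the completion\<close>

lemma isometric_embedding: "isometric \<iota>"
  using compl by (simp add: is_completion_def isometric_def)

lemma dense_range: "closure (range \<iota>) = UNIV"
  using compl by (simp add: is_completion_def)

lemma extension_unique:
  assumes "continuous_on UNIV h" "\<And>x. h (\<iota> x) = \<iota> (g x)"
  shows "extension \<iota> g = h"
  unfolding extension_def
proof (rule the_equality)
  show "k = h" if "continuous_on UNIV k \<and> (\<forall>x. k (\<iota> x) = \<iota> (g x))" for k
    using that assms by (intro continuous_eq_from_dense[OF _ _ dense_range]) auto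
qed (use assms in auto)

text \<open>Transporting \<open>g\<close> along \<open>\<iota>\<close> gives a distance-preserving,
  hence uniformly continuous, map on the dense range, which extends to the completion.\<close>

lemma extension_properties:
  assumes "isometric g"
  shows "isometric (extension \<iota> g)" "extension \<iota> g (\<iota> x) = \<iota> (g x)"
proof -
  let ?f = "\<lambda>w. \<iota> (g (inv \<iota> w))"
  have inj: "inv \<iota> (\<iota> x) = x" for x
    using isometric_inj[OF isometric_embedding] by simp
  have f: "dist (?f v) (?f w) = dist v w" if "v \<in> range \<iota>" "w \<in> range \<iota>" for v w
    using that assms isometric_embedding by (auto simp: inj isometricD)
  have "uniformly_continuous_on (range \<iota>) ?f"
    unfolding uniformly_continuous_on_def using f by metis
  then obtain h where h: "uniformly_continuous_on (closure (range \<iota>)) h"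
    "\<And>w. w \<in> range \<iota> \<Longrightarrow> ?f w = h w"
    by (rule uniformly_continuous_on_extension_on_closure) blast
  have cont: "continuous_on UNIV h"
    using h(1) dense_range uniformly_continuous_imp_continuous by auto
  have ext: "h (\<iota> x) = \<iota> (g x)" for x using h(2)[of "\<iota> x"] by (simp add: inj)
  have eq: "extension \<iota> g = h" by (rule extension_unique[OF cont ext])
  show "extension \<iota> g (\<iota> x) = \<iota> (g x)" by (simp add: eq ext)
  \<comment> \<open>Preservation of distances is an equation between continuous functions on the
    square of the completion, so it may be checked on a dense subset.\<close>
  have "(\<lambda>p. dist (h (fst p)) (h (snd p))) = (\<lambda>p. dist (fst p) (snd p))"
  proof (rule continuous_eq_from_dense)
    show "continuous_on UNIV (\<lambda>p. dist (h (fst p)) (h (snd p)))"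
      by (intro continuous_intros continuous_on_compose2[OF cont]) auto
    show "continuous_on UNIV (\<lambda>p::'b \<times> 'b. dist (fst p) (snd p))"
      by (intro continuous_intros)
    show "closure (range \<iota> \<times> range \<iota>) = UNIV" by (simp add: closure_Times dense_range)
    show "dist (h (fst p)) (h (snd p)) = dist (fst p) (snd p)" if "p \<in> range \<iota> \<times> range \<iota>" for p
      using that assms isometric_embedding by (auto simp: ext isometricD)
  qed
  from fun_cong[OF this, of "(v, w)" for v w] have "dist (h v) (h w) = dist v w" for v w
    by simp
  then show "isometric (extension \<iota> g)" by (simp add: eq isometric_def)
qed

lemma extension_compose:
  assumes "isometric f" "isometric g"
  shows "extension \<iota> (f \<circ> g) = extension \<iota> f \<circ> extension \<iota> g"
proof (rule extension_unique)
  show "continuous_on UNIV (extension \<iota> f \<circ> extension \<iota> g)"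
    using assms by (intro continuous_on_compose isometric_continuous extension_properties)
qed (use assms in \<open>simp add: extension_properties\<close>)

lemma extension_inv:
  assumes "g \<in> Iso"
  shows "extension \<iota> g (extension \<iota> (inv g) w) = w"
proof -
  have "extension \<iota> (g \<circ> inv g) = id"
    by (rule extension_unique) (use assms in \<open>auto simp: Iso_iff surj_f_inv_f\<close>)
  then show ?thesis
    using extension_compose[of g "inv g"] assms inv_in_Iso[OF assms]
    by (metis Iso_iff comp_apply id_apply)
qed

text \<open>Pointwise limits of isometric maps are isometric, hence continuous, so closing inside
  \<open>Cont\<close> gives the same set as closing in the space of all maps.\<close>

lemma Ellis_eq_closure: "Ellis \<iota> = closure (extension \<iota> ` Iso)"
  and Ellis_isometric: "f \<in> Ellis \<iota> \<Longrightarrow> isometric f"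
proof -
  have iso: "isometric f" if f: "f \<in> closure (extension \<iota> ` Iso)" for f
  \<comment> \<open>The filter \<open>at f within\<close> a set is proper only at limit points of
    that set, so members of the set are treated apart.\<close>
  proof (cases "f \<in> extension \<iota> ` Iso")
    case True
    then show ?thesis using extension_properties(1) by (auto simp: Iso_iff)
  next
    case False
    with f have "f islimpt (extension \<iota> ` Iso)" by (simp add: closure_def)
    then have nb: "at f within (extension \<iota> ` Iso) \<noteq> bot"
      by (simp add: trivial_limit_within)
    have "eventually isometric (at f within (extension \<iota> ` Iso))"
      unfolding eventually_at_topological using extension_properties(1)
      by (intro exI[of _ UNIV]) (auto simp: Iso_iff)
    with nb tendsto_ident_at show ?thesis
      using isometric_limit[of _ "\<lambda>x. x" f] by blast
  qed
  have "extension \<iota> ` Iso \<subseteq> Cont"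
    by (auto simp: Iso_iff Cont_def intro!: isometric_continuous extension_properties(1))
  moreover have "closure (extension \<iota> ` Iso) \<subseteq> Cont"
    using iso isometric_continuous by (auto simp: Cont_def)
  ultimately show eq: "Ellis \<iota> = closure (extension \<iota> ` Iso)"
    by (simp add: Ellis_def closure_of_subtopology Int_absorb1 Int_absorb2)
  show "isometric f" if "f \<in> Ellis \<iota>" using that iso eq by simp
qed

section \<open>Limits, evaluation and composition in the Ellis semigroup\<close>

lemma extension_in_Ellis: "g \<in> Iso \<Longrightarrow> extension \<iota> g \<in> Ellis \<iota>"
  by (simp add: Ellis_eq_closure closure_subset[THEN subsetD])

lemma Ellis_limit:
  assumes "F \<noteq> bot" "eventually (\<lambda>i. f i \<in> Ellis \<iota>) F" "(f \<longlongrightarrow> k) F"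
  shows "k \<in> Ellis \<iota>"
  using Lim_in_closed_set[of "Ellis \<iota>" f F k] assms by (simp add: Ellis_eq_closure)

lemma continuous_Ellis_eval:
  "continuous_on (Ellis \<iota> \<times> Y) (\<lambda>(f, y). (y, f y))"
  unfolding continuous_on_def
proof (clarify)
  fix k y assume "k \<in> Ellis \<iota>" "y \<in> Y"
  let ?F = "at (k, y) within Ellis \<iota> \<times> Y"
  have id: "((\<lambda>p. p) \<longlongrightarrow> (k, y)) ?F" by (rule tendsto_ident_at)
  have k: "((\<lambda>p. fst p y) \<longlongrightarrow> k y) ?F" and y: "(snd \<longlongrightarrow> y) ?F"
    using tendsto_fst[OF id] tendsto_snd[OF id] by (simp_all add: tendsto_fun_iff)
  have "eventually (\<lambda>p. isometric (fst p)) ?F"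
    unfolding eventually_at_topological using Ellis_isometric by (intro exI[of _ UNIV]) auto
  from tendsto_isometric_eval[OF this y] k have "((\<lambda>p. fst p (snd p)) \<longlongrightarrow> k y) ?F" by simp
  with y show "((\<lambda>(f, y). (y, f y)) \<longlongrightarrow> (y, k y)) ?F"
    by (simp add: case_prod_unfold tendsto_Pair)
qed

text \<open>Left translation by a fixed extension is continuous for pointwise convergence and maps
  extensions to extensions, so the preimage of the closed Ellis semigroup contains their
  closure.\<close>

lemma extension_comp_Ellis:
  assumes "g \<in> Iso" "h \<in> Ellis \<iota>"
  shows "extension \<iota> g \<circ> h \<in> Ellis \<iota>"
proof -
  have cont: "continuous_on UNIV (\<lambda>k w. extension \<iota> g (k w))"
    by (intro continuous_on_coordinatewise_then_product
        continuous_on_compose2[OF isometric_continuous[OF extension_properties(1)]])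
      (use assms(1) in \<open>auto simp: Iso_iff\<close>)
  have "extension \<iota> ` Iso \<subseteq> (\<lambda>k w. extension \<iota> g (k w)) -` Ellis \<iota>"
  proof clarsimp
    fix f :: "'a \<Rightarrow> 'a" assume f: "f \<in> Iso"
    then have "g \<circ> f \<in> Iso" using assms(1) comp_surj[of f g] by (simp add: Iso_iff isometric_def)
    from extension_in_Ellis[OF this] f assms(1)
    show "(\<lambda>w. extension \<iota> g (extension \<iota> f w)) \<in> Ellis \<iota>"
      using extension_compose[of g f] by (simp add: Iso_iff comp_def)
  qed
  then have "Ellis \<iota> \<subseteq> (\<lambda>k w. extension \<iota> g (k w)) -` Ellis \<iota>"
    unfolding Ellis_eq_closure by (intro closure_minimal closed_vimage cont closed_closure)
  with assms(2) show ?thesis by (auto simp: comp_def)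
qed

text \<open>Right translation by \<open>h\<close> only reindexes coordinates and so is continuous;
  \<open>extension_comp_Ellis\<close> handles the extensions, and passing to the closure does the
  rest.\<close>

lemma Ellis_comp:
  assumes "f \<in> Ellis \<iota>" "h \<in> Ellis \<iota>"
  shows "f \<circ> h \<in> Ellis \<iota>"
proof -
  have cont: "continuous_on UNIV (\<lambda>(k :: 'b \<Rightarrow> 'b) w. k (h w))"
    by (intro continuous_on_coordinatewise_then_product) simp
  have "extension \<iota> ` Iso \<subseteq> (\<lambda>k w. k (h w)) -` Ellis \<iota>"
    using extension_comp_Ellis assms(2) by (auto simp: comp_def)
  then have "Ellis \<iota> \<subseteq> (\<lambda>k w. k (h w)) -` Ellis \<iota>"
    unfolding Ellis_eq_closure by (intro closure_minimal closed_vimage cont closed_closure)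
  with assms(1) show ?thesis by (auto simp: comp_def)
qed

lemma Hlim_in_Ellis:
  assumes "h \<in> Hlim \<iota>"
  shows "h \<in> Ellis \<iota>"
proof -
  obtain g where g: "\<And>n. g n \<in> Iso" "(\<lambda>n. extension \<iota> (g n)) \<longlonglongrightarrow> h"
    using assms by (auto simp: Hlim_def)
  show ?thesis
    by (rule Ellis_limit[OF sequentially_bot _ g(2)]) (simp add: extension_in_Ellis g(1))
qed

section \<open>Properness\<close>

text \<open>
  A filter on the Ellis semigroup is replaced by one on \<open>Iso\<close> by choosing, for every finite set
  \<open>A\<close> and every \<open>n\<close>, an isometry that agrees with the given map on \<open>A\<close> up to \<open>1 / (n + 1)\<close>.
\<close>

lemma Ellis_cluster_range:
  fixes f :: "'i \<Rightarrow> 'b \<Rightarrow> 'b"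
  assumes ci: "cauchy_indivisible (Iso :: ('a \<Rightarrow> 'a) set)"
    and F: "F \<noteq> bot" and E: "eventually (\<lambda>i. f i \<in> Ellis \<iota>) F"
    and lim: "((\<lambda>i. f i (\<iota> x)) \<longlongrightarrow> z) F"
  obtains k G where "k \<in> Ellis \<iota>" "G \<noteq> bot" "G \<le> F" "(f \<longlongrightarrow> k) G"
proof -
  \<comment> \<open>The conditions on \<open>f i\<close> and \<open>A\<close> stand under the
    existential quantifier so that one choice \<open>g0\<close> covers all indices;
    \<open>id\<close> is the default where they fail.\<close>
  have "\<exists>g\<in>Iso. f i \<in> Ellis \<iota> \<and> finite A \<longrightarrow>
      (\<forall>w\<in>A. dist (f i w) (extension \<iota> g w) < inverse (real (Suc n)))" for i A n
  proof (cases "f i \<in> Ellis \<iota> \<and> finite A")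
    case True
    then show ?thesis
      using closure_fun_approx[of "f i" "extension \<iota> ` Iso" A "inverse (real (Suc n))"]
      by (auto simp: Ellis_eq_closure)
  next
    case False
    have "id \<in> (Iso :: ('a \<Rightarrow> 'a) set)" by (simp add: Iso_def)
    with False show ?thesis by blast
  qed
  then obtain g0 where g0: "\<And>i A n. g0 i A n \<in> Iso"
    "\<And>i A n w. f i \<in> Ellis \<iota> \<Longrightarrow> finite A \<Longrightarrow> w \<in> A \<Longrightarrow>
       dist (f i w) (extension \<iota> (g0 i A n) w) < inverse (real (Suc n))"
    by metis
  define g where "g = (\<lambda>(i, A, n). g0 i A n)"
  \<comment> \<open>Along \<open>P\<close> the finite set comes to contain any given point and the
    error bound tends to 0, so \<open>f\<close> and the extensions of \<open>g\<close> become
    arbitrarily close at each point.\<close>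
  define P where "P = F \<times>\<^sub>F (finite_subsets_at_top (UNIV :: 'b set) \<times>\<^sub>F sequentially)"
  have P: "P \<noteq> bot" using F by (simp add: P_def prod_filter_eq_bot)
  have fst: "filtermap fst P \<le> F" unfolding P_def by (rule filtermap_fst_prod_filter)
  have g_iso: "g p \<in> Iso" for p using g0(1) by (simp add: g_def split: prod.split)
  have ext: "extension \<iota> (g p) (\<iota> x) = \<iota> (g p x)" for p x
    using g_iso by (simp add: Iso_iff extension_properties(2))
  have close: "((\<lambda>p. dist (f (fst p) w) (extension \<iota> (g p) w)) \<longlongrightarrow> 0) P" for w
  proof (rule tendstoI)
    fix e :: real assume "e > 0"
    have A: "eventually (\<lambda>A. finite A \<and> w \<in> A) (finite_subsets_at_top (UNIV :: 'b set))"
      unfolding eventually_finite_subsets_at_top by (intro exI[of _ "{w}"]) auto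
    have "eventually (\<lambda>n. inverse (real (Suc n)) < e) sequentially"
      using order_tendstoD(2)[OF LIMSEQ_inverse_real_of_nat \<open>e > 0\<close>] .
    from eventually_prodI[OF E eventually_prodI[OF A this]]
    show "eventually (\<lambda>p. dist (dist (f (fst p) w) (extension \<iota> (g p) w)) 0 < e) P"
      unfolding P_def
    proof eventually_elim
      case (elim p)
      then show ?case using g0(2)[of "fst p" "fst (snd p)" w "snd (snd p)"]
        by (simp add: g_def case_prod_unfold)
    qed
  qed
  have "((\<lambda>p. f (fst p) (\<iota> x)) \<longlongrightarrow> z) P"
    using filterlim_compose[OF lim, of fst P] fst by (simp add: filterlim_def)
  from tendsto_of_dist[OF this close] have "((\<lambda>p. \<iota> (g p x)) \<longlongrightarrow> z) P"
    by (simp add: ext)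
  then have "cauchy_filter (filtermap (\<lambda>p. \<iota> (g p x)) P)"
    using convergent_iff_cauchy_filtermap by blast
  then have cauchy: "cauchy_filter (filtermap (\<lambda>h. h x) (filtermap g P))"
    by (simp add: isometric_cauchy_filtermap[OF isometric_embedding] filtermap_filtermap)
  \<comment> \<open>Either \<open>P\<close> itself serves, as Cauchy-indivisibility spreads the
    Cauchy property from \<open>x\<close> to all points, or a finer filter converges in
    \<open>Iso\<close> and its lift below \<open>P\<close> serves.\<close>
  obtain P' where P': "P' \<noteq> bot" "P' \<le> P" "\<And>x. \<exists>l. ((\<lambda>p. \<iota> (g p x)) \<longlongrightarrow> l) P'"
  proof (cases "to_infinity_in Iso (filtermap g P)")
    case True
    have "filtermap g P \<le> principal Iso"
      using g_iso by (simp add: le_principal eventually_filtermap)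
    with True cauchy P ci have "cauchy_filter (filtermap (\<lambda>h. h x) (filtermap g P))" for x
      unfolding cauchy_indivisible_def by (metis filtermap_bot_iff)
    then have "\<exists>l. ((\<lambda>p. \<iota> (g p x)) \<longlongrightarrow> l) P" for x
      by (simp add: convergent_iff_cauchy_filtermap
          isometric_cauchy_filtermap[OF isometric_embedding] filtermap_filtermap)
    with P that show thesis by blast
  next
    case False
    then obtain h G where G: "G \<noteq> bot" "G \<le> filtermap g P" "((\<lambda>x. x) \<longlongrightarrow> h) G"
      unfolding to_infinity_in_def by blast
    from finer_filter_lift[OF G(1,2)] obtain P' where
      P': "P' \<noteq> bot" "P' \<le> P" "filtermap g P' \<le> G" .
    have "(g \<longlongrightarrow> h) P'" using P'(3) G(3) by (simp add: filterlim_def)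
    then have "((\<lambda>p. \<iota> (g p x)) \<longlongrightarrow> \<iota> (h x)) P'" for x
      using isometric_continuous[OF isometric_embedding, of UNIV]
      by (auto simp: tendsto_fun_iff intro: continuous_on_tendsto_compose)
    with P' that show thesis by blast
  qed
  have "filtermap fst P' \<le> F" using fst P'(2) filtermap_mono order_trans by blast
  then have E': "eventually (\<lambda>p. f (fst p) \<in> Ellis \<iota>) P'"
    using filter_leD[of "filtermap fst P'" F, OF _ E] by (simp add: eventually_filtermap)
  \<comment> \<open>Closeness now carries the limits back from the isometries to \<open>f\<close>,
    at first only on the dense range.\<close>
  have conv: "\<exists>l. ((\<lambda>p. f (fst p) w) \<longlongrightarrow> l) P'" if w: "w \<in> range \<iota>" for w
  proof -
    obtain x where x: "w = \<iota> x" using w by blast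
    obtain l where l: "((\<lambda>p. extension \<iota> (g p) w) \<longlongrightarrow> l) P'"
      using P'(3)[of x] by (auto simp: x ext)
    have "((\<lambda>p. dist (extension \<iota> (g p) w) (f (fst p) w)) \<longlongrightarrow> 0) P'"
      using tendsto_mono[OF P'(2) close[of w]] by (simp add: dist_commute)
    from tendsto_of_dist[OF l this] show ?thesis by blast
  qed
  have iso: "eventually (\<lambda>p. isometric (f (fst p))) P'"
    using E' by eventually_elim (rule Ellis_isometric)
  obtain k where k: "((\<lambda>p. f (fst p)) \<longlongrightarrow> k) P'"
    using isometric_convergent_from_dense[OF iso dense_range conv] ..
  show thesis
  proof (rule that)
    show "k \<in> Ellis \<iota>" by (rule Ellis_limit[OF P'(1) E' k])
    show "filtermap fst P' \<noteq> bot" using P'(1) by (simp add: filtermap_bot_iff)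
    show "filtermap fst P' \<le> F" by fact
    show "(f \<longlongrightarrow> k) (filtermap fst P')" using k by (simp add: filterlim_filtermap)
  qed
qed

lemma Ellis_cluster:
  fixes f :: "'i \<Rightarrow> 'b \<Rightarrow> 'b"
  assumes ci: "cauchy_indivisible (Iso :: ('a \<Rightarrow> 'a) set)"
    and F: "F \<noteq> bot" and E: "eventually (\<lambda>i. f i \<in> Ellis \<iota>) F"
    and lim: "((\<lambda>i. f i y) \<longlongrightarrow> z) F" and y: "y \<in> range \<iota> \<union> X_p \<iota>"
  obtains k G where "k \<in> Ellis \<iota>" "G \<noteq> bot" "G \<le> F" "(f \<longlongrightarrow> k) G"
proof (cases "y \<in> range \<iota>")
  case True
  then obtain x where "y = \<iota> x" by blast
  with Ellis_cluster_range[OF ci F E, of x z] lim that show thesis by blast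
next
  case False
  then obtain h x where h: "h \<in> Hlim \<iota>" "h \<in> Iso" and y: "y = h (\<iota> x)"
    using y by (auto simp: X_p_def)
  have E': "eventually (\<lambda>i. f i \<circ> h \<in> Ellis \<iota>) F"
    using E by eventually_elim (rule Ellis_comp[OF _ Hlim_in_Ellis[OF h(1)]])
  have "((\<lambda>i. (f i \<circ> h) (\<iota> x)) \<longlongrightarrow> z) F" using lim y by simp
  from Ellis_cluster_range[OF ci F E' this] obtain k G
    where k: "G \<noteq> bot" "G \<le> F" "((\<lambda>i. f i \<circ> h) \<longlongrightarrow> k) G" .
  \<comment> \<open>Each \<open>w\<close> equals \<open>h (inv h w)\<close> because \<open>h\<close>
    is onto, so the limit of \<open>f i \<circ> h\<close> yields one of \<open>f i\<close>.\<close>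
  have "((\<lambda>i. f i w) \<longlongrightarrow> k (inv h w)) G" for w
    using k(3)[unfolded tendsto_fun_iff, rule_format, of "inv h w"] h(2)
    by (simp add: Iso_iff surj_f_inv_f)
  then have lim': "(f \<longlongrightarrow> (k \<circ> inv h)) G" by (simp add: tendsto_fun_iff)
  have "eventually (\<lambda>i. f i \<in> Ellis \<iota>) G" using E k(2) by (simp add: le_filter_def)
  from Ellis_limit[OF k(1) this lim'] k(1,2) lim' that show thesis by blast
qed

text \<open>A metrizable space is a Hausdorff k-space, and for continuous maps into such a space
  properness amounts to compactness of the preimages of compact sets.\<close>

lemma omega_proper_iff:
  "omega_proper \<iota> Y \<longleftrightarrow>
     (\<forall>K \<subseteq> Y \<times> UNIV. compact K \<longrightarrow> compact {(f, y). f \<in> Ellis \<iota> \<and> y \<in> Y \<and> (y, f y) \<in> K})"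
proof -
  let ?S = "top_of_set (Ellis \<iota> \<times> Y)" and ?T = "top_of_set (Y \<times> (UNIV :: 'b set))"
  have T: "prod_topology (top_of_set Y) euclidean = ?T"
    using prod_topology_subtopology_eu[of Y "UNIV :: 'b set"] by simp
  have met: "metrizable_space ?T"
    by (intro metrizable_space_subtopology metrizable_space_euclidean)
  have cont: "continuous_map ?S ?T (\<lambda>(f, y). (y, f y))"
    using continuous_Ellis_eval by (auto simp: continuous_map_in_subtopology)
  have "proper_map ?S ?T (\<lambda>(f, y). (y, f y)) \<longleftrightarrow>
    (\<forall>K. compactin ?T K \<longrightarrow> compactin ?S {p \<in> topspace ?S. (case p of (f, y) \<Rightarrow> (y, f y)) \<in> K})"
    using met cont continuous_map_funspace[OF cont]
    by (subst proper_eq_compact_map)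
      (auto simp: metrizable_imp_k_space Hausdorff_imp_kc_space metrizable_imp_Hausdorff_space)
  moreover have "{p \<in> topspace ?S. (case p of (f, y) \<Rightarrow> (y, f y)) \<in> K} =
      {(f, y). f \<in> Ellis \<iota> \<and> y \<in> Y \<and> (y, f y) \<in> K}" for K by auto
  ultimately show ?thesis
    using cont unfolding omega_proper_def bourbaki_proper_def T
    by (auto simp: compactin_subtopology)
qed

text \<open>Compactness of \<open>K\<close> gives a cluster point \<open>(y, z)\<close> of the image
  pairs, and \<open>Ellis_cluster\<close> at \<open>y\<close> gives one, \<open>k\<close>, for the
  maps; uniqueness of limits yields \<open>k y = z\<close>, so \<open>(k, y)\<close> lies in the
  preimage.\<close>

lemma omega_proper_X_p:
  assumes ci: "cauchy_indivisible (Iso :: ('a \<Rightarrow> 'a) set)"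
  shows "omega_proper \<iota> (range \<iota> \<union> X_p \<iota>)"
  unfolding omega_proper_iff
proof (intro allI impI)
  let ?Y = "range \<iota> \<union> X_p \<iota>"
  fix K :: "('b \<times> 'b) set" assume K: "K \<subseteq> ?Y \<times> UNIV" "compact K"
  define C where "C = {(f, y). f \<in> Ellis \<iota> \<and> y \<in> ?Y \<and> (y, f y) \<in> K}"
  have "compact C"
    unfolding compact_filter
  proof (intro allI impI)
    fix F assume F: "F \<noteq> bot" "eventually (\<lambda>p. p \<in> C) F"
    have "eventually (\<lambda>p. (snd p, fst p (snd p)) \<in> K) F"
      using F(2) by eventually_elim (auto simp: C_def)
    from cluster_point_finer_filter[OF K(2) F(1) this] obtain q G where
      q: "q \<in> K" "G \<noteq> bot" "G \<le> F" "((\<lambda>p. (snd p, fst p (snd p))) \<longlongrightarrow> q) G" .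
    obtain y z where yz: "q = (y, z)" by fastforce
    have E: "eventually (\<lambda>p. fst p \<in> Ellis \<iota>) G"
      using filter_leD[OF q(3) F(2)] by eventually_elim (auto simp: C_def)
    then have iso: "eventually (\<lambda>p. isometric (fst p)) G"
      by eventually_elim (rule Ellis_isometric)
    have y: "(snd \<longlongrightarrow> y) G" and "((\<lambda>p. fst p (snd p)) \<longlongrightarrow> z) G"
      using tendsto_fst[OF q(4)] tendsto_snd[OF q(4)] by (simp_all add: yz)
    then have z: "((\<lambda>p. fst p y) \<longlongrightarrow> z) G" by (simp add: tendsto_isometric_eval[OF iso])
    have yY: "y \<in> ?Y" using q(1) K(1) by (auto simp: yz)
    from Ellis_cluster[OF ci q(2) E z yY] obtain k G'
      where k: "k \<in> Ellis \<iota>" "G' \<noteq> bot" "G' \<le> G" "(fst \<longlongrightarrow> k) G'" .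
    have "k y = z"
      using k(4) tendsto_unique[OF k(2)] tendsto_mono[OF k(3) z]
      by (auto simp: tendsto_fun_iff)
    then have "(k, y) \<in> C" using k(1) yY q(1) by (auto simp: C_def yz)
    moreover have "((\<lambda>p. p) \<longlongrightarrow> (k, y)) G'"
      using tendsto_Pair[OF k(4) tendsto_mono[OF k(3) y]] by simp
    then have "G' \<le> inf (nhds (k, y)) F"
      using k(3) q(3) by (simp add: filterlim_def)
    with k(2) have "inf (nhds (k, y)) F \<noteq> bot" by (metis bot.extremum_unique)
    ultimately show "\<exists>p\<in>C. inf (nhds p) F \<noteq> bot" by blast
  qed
  then show "compact {(f, y). f \<in> Ellis \<iota> \<and> y \<in> ?Y \<and> (y, f y) \<in> K}" by (simp add: C_def)
qed

section \<open>Maximality\<close>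

lemma omega_proper_imp_surj:
  assumes Y: "omega_proper \<iota> Y" and hY: "h (\<iota> x) \<in> Y"
    and g: "\<And>n. g n \<in> Iso" and lim: "(\<lambda>n. extension \<iota> (g n)) \<longlonglongrightarrow> h"
  shows "surj h"
proof -
  let ?y = "h (\<iota> x)"
  let ?f = "\<lambda>n. extension \<iota> (inv (g n))"
  have iso: "isometric (extension \<iota> (g n))" for n
    using g by (simp add: Iso_iff extension_properties(1))
  \<comment> \<open>Moving the isometry across the distance turns convergence of the extensions at
    \<open>v\<close> to \<open>w\<close> into convergence of their inverses at \<open>w\<close> to
    \<open>v\<close>, and back.\<close>
  have dist_inv: "dist (extension \<iota> (g n) v) w = dist v (?f n w)" for n v w
    using isometricD[OF iso, of n v "?f n w"] by (simp add: extension_inv g)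
  have lim': "(\<lambda>n. extension \<iota> (g n) w) \<longlonglongrightarrow> h w" for w
    using lim by (simp add: tendsto_fun_iff)
  have "(\<lambda>n. dist (extension \<iota> (g n) (\<iota> x)) ?y) \<longlonglongrightarrow> 0"
    using lim' by (simp add: tendsto_dist_iff[symmetric])
  then have "(\<lambda>n. ?f n ?y) \<longlonglongrightarrow> \<iota> x"
    unfolding dist_inv tendsto_dist_iff[of _ "\<iota> x"] by (simp add: dist_commute)
  then have "(\<lambda>n. (?y, ?f n ?y)) \<longlonglongrightarrow> (?y, \<iota> x)" by (intro tendsto_intros)
  \<comment> \<open>The points \<open>(?y, ?f n ?y)\<close> are the images of
    \<open>(?f n, ?y)\<close> under the proper map; with their limit they form a compact
    set.\<close>
  then have "compactin euclidean (insert (?y, \<iota> x) (range (\<lambda>n. (?y, ?f n ?y))))"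
    by (intro compactin_sequence_with_limit) auto
  then have "compact (insert (?y, \<iota> x) (range (\<lambda>n. (?y, ?f n ?y))))" (is "compact ?K") by simp
  moreover have "?K \<subseteq> Y \<times> UNIV" using hY by auto
  ultimately have C: "compact {(f, y). f \<in> Ellis \<iota> \<and> y \<in> Y \<and> (y, f y) \<in> ?K}"
    using Y unfolding omega_proper_iff by blast
  have "eventually (\<lambda>n. (?f n, ?y) \<in> {(f, y). f \<in> Ellis \<iota> \<and> y \<in> Y \<and> (y, f y) \<in> ?K}) sequentially"
    using hY by (auto simp: extension_in_Ellis inv_in_Iso g)
  from cluster_point_finer_filter[OF C sequentially_bot this] obtain q G where
    G: "G \<noteq> bot" "G \<le> sequentially" "((\<lambda>n. (?f n, ?y)) \<longlongrightarrow> q) G" .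
  have k: "((\<lambda>n. ?f n w) \<longlongrightarrow> fst q w) G" for w
    using tendsto_fst[OF G(3)] by (simp add: tendsto_fun_iff)
  \<comment> \<open>Two limits of \<open>extension \<iota> (g n) (fst q w)\<close> are compared: one
    is given by \<open>lim'\<close>, the other is \<open>w\<close> because the inverses at
    \<open>w\<close> tend to \<open>fst q w\<close>.\<close>
  have "h (fst q w) = w" for w
  proof (rule tendsto_unique[OF G(1)])
    show "((\<lambda>n. extension \<iota> (g n) (fst q w)) \<longlongrightarrow> h (fst q w)) G"
      using tendsto_mono[OF G(2) lim'] .
    have "((\<lambda>n. dist (?f n w) (fst q w)) \<longlongrightarrow> 0) G" using k by (simp add: tendsto_dist_iff[symmetric])
    then show "((\<lambda>n. extension \<iota> (g n) (fst q w)) \<longlongrightarrow> w) G"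
      unfolding tendsto_dist_iff[of _ w] dist_inv by (simp add: dist_commute)
  qed
  then show "surj h" by (metis surjI)
qed

text \<open>A point of \<open>Y\<close> outside the range is \<open>h (\<iota> x)\<close> with
  \<open>h\<close> in \<open>Hlim \<iota>\<close>. Properness makes this same \<open>h\<close> onto,
  and it is isometric as an element of the Ellis semigroup.\<close>

lemma omega_proper_imp_subset:
  assumes "omega_proper \<iota> Y" "Y \<subseteq> range \<iota> \<union> X_l \<iota>"
  shows "Y \<subseteq> range \<iota> \<union> X_p \<iota>"
proof
  fix y assume y: "y \<in> Y"
  show "y \<in> range \<iota> \<union> X_p \<iota>"
  proof (cases "y \<in> range \<iota>")
    case False
    with y assms(2) obtain h x where h: "h \<in> Hlim \<iota>" "y = h (\<iota> x)"
      by (auto simp: X_l_def)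
    then obtain g where "\<And>n. g n \<in> Iso" "(\<lambda>n. extension \<iota> (g n)) \<longlonglongrightarrow> h"
      by (auto simp: Hlim_def)
    then have "surj h" using omega_proper_imp_surj assms(1) y h(2) by blast
    then have "h \<in> Iso" using Ellis_isometric Hlim_in_Ellis h(1) by (simp add: Iso_iff)
    with h show ?thesis by (auto simp: X_p_def)
  qed simp
qed

end

theorem theorem5p12:
  fixes \<iota> :: "'a::metric_space \<Rightarrow> 'b::complete_space"
  assumes "separable_space (euclidean :: 'a topology)"
    and "cauchy_indivisible (Iso :: ('a \<Rightarrow> 'a) set)"
    and "is_completion \<iota>"
  shows "range \<iota> \<union> X_p \<iota> \<subseteq> range \<iota> \<union> X_l \<iota>
    \<and> omega_proper \<iota> (range \<iota> \<union> X_p \<iota>)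
    \<and> (\<forall>Y. range \<iota> \<subseteq> Y \<and> Y \<subseteq> range \<iota> \<union> X_l \<iota> \<and> omega_proper \<iota> Y
          \<longrightarrow> Y \<subseteq> range \<iota> \<union> X_p \<iota>)"
proof (intro conjI allI impI)
  show "range \<iota> \<union> X_p \<iota> \<subseteq> range \<iota> \<union> X_l \<iota>" by (auto simp: X_p_def X_l_def)
  show "omega_proper \<iota> (range \<iota> \<union> X_p \<iota>)" using omega_proper_X_p assms(2,3) by blast
  show "Y \<subseteq> range \<iota> \<union> X_p \<iota>"
    if "range \<iota> \<subseteq> Y \<and> Y \<subseteq> range \<iota> \<union> X_l \<iota> \<and> omega_proper \<iota> Y" for Y
    using omega_proper_imp_subset assms(3) that by blast
qed

end
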